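(* Let $p_1,\dots,p_m$ be independent $p$-values with set of true nulls $\mathcal H_0\subset\{1,\dots,m\}$, such that $p_i\sim U(0,1)$ for $i\in\mathcal H_0$, let $\pi$ be a deterministic permutation of $\{1,\dots,m\}$ and let $s\in(0,1]$. For all $\delta\in(0,1)$ and $\lambda\in[s,1)$, setting $R_k=\{\pi(i):1\le i\le k,\ p_{\pi(i)}\le s\}$ and $$\overline{\mathrm{FDP}}_k^{\mathrm{KR\text{-}U}}=1\wedge\min_{a\in\mathbb N\setminus\{0\}}\left\{\frac{\log(1/\delta_a)}{a\log\Bigl(1+\frac{1-\delta_a^{B/a}}{B}\Bigr)}\cdot\frac{a+\frac{s}{1-\lambda}\sum_{i=1}^k\mathbf 1\{p_{\pi(i)}>\lambda\}}{1\vee\sum_{i=1}^k\mathbf 1\{p_{\pi(i)}\le s\}}\right\},\qquad k=1,\dots,m,$$ with $\delta_a=\delta/(\kappa a^2)$ for $a\ge1$, $B=s/(1-\lambda)$ and $\kappa=\pi_\circ^2/6$ (with $\pi_\circ=3.14159\ldots$), one has $$\mathbf P\bigl(\forall k\in\{1,\dots,m\},\ \mathrm{FDP}(R_k)\le\overline{\mathrm{FDP}}_k^{\mathrm{KR\text{-}U}}\bigr)\ge1-\delta.$$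
   Context: Pre-ordered setting: $p_1,\dots,p_m\in[0,1]$ independent, $\mathcal H_0$ a fixed subset of $\{1,\dots,m\}$, nothing assumed on the marginals of $p_i$ for $i\notin\mathcal H_0$. $\mathrm{FDP}(R)=|R\cap\mathcal H_0|/(|R|\vee1)$. *)

theory Defs
  imports "HOL-Probability.Probability" "HOL-Combinatorics.Permutations"
begin

definition FDP :: "nat set \<Rightarrow> nat set \<Rightarrow> real" where
  "FDP H0 R = real (card (R \<inter> H0)) / real (max (card R) 1)"

definition preordered_rejections ::
    "(nat \<Rightarrow> real) \<Rightarrow> (nat \<Rightarrow> nat) \<Rightarrow> real \<Rightarrow> nat \<Rightarrow> nat set" where
  "preordered_rejections x \<pi> s k = {\<pi> i | i. 1 \<le> i \<and> i \<le> k \<and> x (\<pi> i) \<le> s}"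

definition delta_seq :: "real \<Rightarrow> nat \<Rightarrow> real" where
  "delta_seq \<delta> a = \<delta> / ((pi\<^sup>2 / 6) * (real a)\<^sup>2)"

definition KR_term ::
    "(nat \<Rightarrow> real) \<Rightarrow> (nat \<Rightarrow> nat) \<Rightarrow> real \<Rightarrow> real \<Rightarrow> real \<Rightarrow> nat \<Rightarrow> nat \<Rightarrow> real" where
  "KR_term x \<pi> s lam \<delta> k a =
     (let B = s / (1 - lam); d = delta_seq \<delta> a in
      ln (1 / d) / (real a * ln (1 + (1 - d powr (B / real a)) / B))
      * ((real a + s / (1 - lam) * (\<Sum>i=1..k. of_bool (x (\<pi> i) > lam)))
         / max 1 (\<Sum>i=1..k. of_bool (x (\<pi> i) \<le> s))))"

(* The minimum over the infinite set of positive integers is written as an infimum;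
   it is attained, see KR_term_attains_min. *)
definition FDP_bar_KR_U ::
    "(nat \<Rightarrow> real) \<Rightarrow> (nat \<Rightarrow> nat) \<Rightarrow> real \<Rightarrow> real \<Rightarrow> real \<Rightarrow> nat \<Rightarrow> real" where
  "FDP_bar_KR_U x \<pi> s lam \<delta> k = min 1 (INF a\<in>{1..}. KR_term x \<pi> s lam \<delta> k a)"

lemma KR_term_ge:
  assumes "0 < s" "lam < 1" "0 < \<delta>" "\<delta> < 1" "a \<ge> 1"
  shows "KR_term x \<pi> s lam \<delta> k a \<ge> real a / max 1 (\<Sum>i=1..k. of_bool (x (\<pi> i) \<le> s))"
proof -
  define B where "B = s / (1 - lam)"
  define d where "d = delta_seq \<delta> a"
  define S :: real where "S = (\<Sum>i=1..k. of_bool (x (\<pi> i) > lam))"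
  define N :: real where "N = max 1 (\<Sum>i=1..k. of_bool (x (\<pi> i) \<le> s))"
  have B: "B > 0" using assms by (simp add: B_def)
  have a: "real a \<ge> 1" using assms by simp
  have S: "S \<ge> 0" unfolding S_def by (intro sum_nonneg) simp
  have N: "N \<ge> 1" by (simp add: N_def)
  have "3 * 3 \<le> pi * pi" using pi_gt3 by (intro mult_mono) auto
  hence "pi\<^sup>2 / 6 \<ge> 1" by (simp add: power2_eq_square)
  moreover have "(real a)\<^sup>2 \<ge> 1" using a by simp
  ultimately have D: "(pi\<^sup>2 / 6) * (real a)\<^sup>2 \<ge> 1"
    using mult_mono[of 1 "pi\<^sup>2 / 6" 1 "(real a)\<^sup>2"] by simp
  have d0: "d > 0" unfolding d_def delta_seq_def using D assms by (intro divide_pos_pos) auto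
  have "d \<le> \<delta> / 1" unfolding d_def delta_seq_def using D assms by (intro divide_left_mono) auto
  hence d1: "d < 1" using assms by simp
  define L where "L = ln (1 / d)"
  have L: "L > 0" unfolding L_def using d0 d1 by (intro ln_gt_zero) simp
  define y where "y = (1 - d powr (B / real a)) / B"
  have pw: "d powr (B / real a) = exp (- (B / real a * L))"
    using d0 by (simp add: powr_def L_def ln_div)
  have "d powr (B / real a) < 1" unfolding pw using B L a by simp
  hence y: "y > 0" unfolding y_def using B by simp
  have "1 - d powr (B / real a) \<le> B / real a * L"
    unfolding pw using exp_ge_add_one_self[of "- (B / real a * L)"] by linarith
  hence yl: "real a * y \<le> L" unfolding y_def using B a by (simp add: field_simps)
  have "ln (1 + y) \<le> y" using y by (intro ln_add_one_self_le_self) simp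
  hence "real a * ln (1 + y) \<le> L"
    using yl mult_left_mono[of "ln (1 + y)" y "real a"] by linarith
  moreover have "real a * ln (1 + y) > 0" using a y by simp
  ultimately have c: "1 \<le> L / (real a * ln (1 + y))" by simp
  have "real a / N \<le> (real a + B * S) / N"
    using B S N by (intro divide_right_mono) auto
  also have "\<dots> \<le> L / (real a * ln (1 + y)) * ((real a + B * S) / N)"
    using mult_right_mono[OF c, of "(real a + B * S) / N"] B S N a by simp
  also have "\<dots> = KR_term x \<pi> s lam \<delta> k a"
    unfolding KR_term_def Let_def L_def y_def B_def d_def S_def N_def by simp
  finally show ?thesis unfolding N_def .
qed

lemma KR_term_attains_min:
  assumes "0 < s" "lam < 1" "0 < \<delta>" "\<delta> < 1"
  obtains a where "a \<ge> 1"
    and "(INF b\<in>{1..}. KR_term x \<pi> s lam \<delta> k b) = KR_term x \<pi> s lam \<delta> k a"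
    and "\<And>b. b \<ge> 1 \<Longrightarrow> KR_term x \<pi> s lam \<delta> k a \<le> KR_term x \<pi> s lam \<delta> k b"
proof -
  let ?T = "KR_term x \<pi> s lam \<delta> k"
  define N :: real where "N = max 1 (\<Sum>i=1..k. of_bool (x (\<pi> i) \<le> s))"
  have N: "N \<ge> 1" by (simp add: N_def)
  obtain K :: nat where K: "real K \<ge> ?T 1 * N" using real_arch_simple by blast
  define M where "M = max 1 K"
  have fin: "finite {1..M}" "{1..M} \<noteq> {}" by (auto simp: M_def)
  have "Min (?T ` {1..M}) \<in> ?T ` {1..M}" using fin by (intro Min_in) auto
  then obtain a where a: "a \<in> {1..M}" "?T a = Min (?T ` {1..M})" by auto
  have le: "?T a \<le> ?T b" if b: "b \<ge> 1" for b
  proof (cases "b \<le> M")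
    case True
    with b have "b \<in> {1..M}" by simp
    thus ?thesis unfolding a(2) using fin by (intro Min_le) auto
  next
    case False
    have "?T a \<le> ?T 1" unfolding a(2) using fin by (intro Min_le) (auto simp: M_def)
    also have "\<dots> \<le> real b / N" using K False N by (simp add: M_def field_simps)
    also have "\<dots> \<le> ?T b" unfolding N_def by (intro KR_term_ge assms b)
    finally show ?thesis .
  qed
  have "(INF b\<in>{1..}. ?T b) = ?T a"
    using a(1) le by (intro cInf_eq_minimum) auto
  with a(1) le show ?thesis by (intro that[of a]) auto
qed

end

theory Submission
  imports Defs
begin

text \<open>
  Let \<open>V\<close> and \<open>W\<close> count the nulls among the first \<open>k\<close> hypotheses whose \<open>p\<close>-value is at most
  \<open>s\<close>, respectively above \<open>lam\<close>, and put \<open>B = s / (1 - lam)\<close>. For every \<open>t \<ge> 0\<close>, with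
  \<open>l = ln (1 + (1 - exp (- t)) / B)\<close>, the process \<open>exp (l * V - t * W)\<close> is a product of independent
  factors of mean 1, so by the maximal inequality it ever reaches \<open>1 / d\<close> with probability at
  most \<open>d\<close>. With \<open>d\<close> the level \<open>delta_seq \<delta> a\<close> and \<open>t = ln (1 / d) * B / a\<close> this is the bound
  belonging to \<open>a\<close>; a union bound over \<open>a\<close> costs \<open>\<delta>\<close> in total because the reciprocal squares
  sum to \<open>pi\<^sup>2 / 6\<close>.
\<close>

section \<open>Products of independent factors, stopped at a level\<close>

text \<open>The recursion tests the old value before multiplying, so the first value reaching
  \<open>c\<close> is kept, overshoot included. Stopping is thus a function of the first
  \<open>k\<close> coordinates alone, which gives measurability and independence from the next
  factor without a filtration.\<close>

primrec stopped_prod :: "real \<Rightarrow> (nat \<Rightarrow> real) \<Rightarrow> nat \<Rightarrow> real" where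
  "stopped_prod c y 0 = 1"
| "stopped_prod c y (Suc k) =
     stopped_prod c y k * (if c \<le> stopped_prod c y k then 1 else y (Suc k))"

lemma stopped_prod_cong:
  assumes "\<And>i. i \<in> {1..k} \<Longrightarrow> y i = z i"
  shows "stopped_prod c y k = stopped_prod c z k"
  using assms by (induction k) auto

lemma stopped_prod_nonneg:
  assumes "\<And>i. i \<in> {1..k} \<Longrightarrow> 0 \<le> y i"
  shows "0 \<le> stopped_prod c y k"
  using assms by (induction k) auto

text \<open>A factor is skipped only after the level \<open>c\<close> has been reached, and from
  then on the value is frozen; until then every factor has been multiplied in.\<close>

lemma stopped_prod_eq_or_ge:
  "stopped_prod c y k = (\<Prod>i=1..k. y i) \<or> c \<le> stopped_prod c y k"
  by (induction k) (auto simp: prod.nat_ivl_Suc')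

lemma stopped_prod_ge_mono:
  assumes "c \<le> stopped_prod c y k" "k \<le> n"
  shows "c \<le> stopped_prod c y n"
  using assms(2,1) by (induction rule: dec_induct) auto

text \<open>The plain product may drop below \<open>c\<close> again after time \<open>k\<close>,
  while the stopped one cannot. Hence an event about all times reduces to one about the final time,
  where Markov's inequality applies.\<close>

lemma prod_ge_imp_stopped_prod_ge:
  assumes "c \<le> (\<Prod>i=1..k. y i)" "k \<le> n"
  shows "c \<le> stopped_prod c y n"
proof (rule stopped_prod_ge_mono[OF _ assms(2)])
  show "c \<le> stopped_prod c y k" using stopped_prod_eq_or_ge[of c y k] assms(1) by auto
qed

lemma measurable_stopped_prod:
  assumes "{1..k} \<subseteq> A"
  shows "(\<lambda>y. stopped_prod c y k) \<in> borel_measurable (PiM A (\<lambda>_. borel))"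
  using assms
proof (induction k)
  case (Suc k)
  have [measurable]: "(\<lambda>y. stopped_prod c y k) \<in> borel_measurable (PiM A (\<lambda>_. borel))"
    using Suc by (auto simp: subset_iff)
  have "Suc k \<in> A" using Suc.prems by (auto simp: subset_iff)
  hence [measurable]: "(\<lambda>y. y (Suc k)) \<in> borel_measurable (PiM A (\<lambda>_. borel))"
    by (rule measurable_component_singleton)
  show ?case by simp
qed simp

text \<open>Stopping the product on first reaching the level \<open>c\<close> keeps its mean at most 1, and the
  stopped product exceeds \<open>c\<close> at time \<open>m\<close> whenever some partial product does.\<close>

theorem (in prob_space) indep_prod_maximal_inequality:
  fixes Y :: "nat \<Rightarrow> 'a \<Rightarrow> real"
  assumes indep: "indep_vars (\<lambda>_. borel) Y {1..m}"
    and nonneg: "\<And>i \<omega>. i \<in> {1..m} \<Longrightarrow> \<omega> \<in> space M \<Longrightarrow> 0 \<le> Y i \<omega>"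
    and int: "\<And>i. i \<in> {1..m} \<Longrightarrow> integrable M (Y i)"
    and mean: "\<And>i. i \<in> {1..m} \<Longrightarrow> expectation (Y i) \<le> 1"
    and c: "0 < c"
  shows "prob {\<omega> \<in> space M. \<exists>k\<in>{1..m}. c \<le> (\<Prod>i=1..k. Y i \<omega>)} \<le> 1 / c"
proof -
  define N where "N k \<omega> = stopped_prod c (\<lambda>i. Y i \<omega>) k" for k \<omega>
  have nn: "0 \<le> N k \<omega>" if "k \<le> m" "\<omega> \<in> space M" for k \<omega>
    unfolding N_def using that nonneg by (intro stopped_prod_nonneg) auto
  have N: "integrable M (N k) \<and> expectation (N k) \<le> 1" if "k \<le> m" for k
    using that
  proof (induction k)
    case 0
    then show ?case by (simp add: N_def prob_space)
  next
    case (Suc k)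
    hence IH: "integrable M (N k)" "expectation (N k) \<le> 1" by auto
    have [measurable]: "N k \<in> borel_measurable M" using IH(1) by simp
    \<comment> \<open>The value is split into the part already stopped (\<open>f\<close>) and the
      part still running (\<open>g\<close>); only the latter is multiplied by the next
      factor.\<close>
    define f where "f u = u * of_bool (c \<le> u)" for u :: real
    define g where "g u = u * of_bool (u < c)" for u :: real
    have fg [measurable]: "f \<in> borel_measurable borel" "g \<in> borel_measurable borel"
      unfolding f_def g_def by measurable
    have split: "f u + g u = u" for u by (simp add: f_def g_def)
    have intf: "integrable M (\<lambda>\<omega>. f (N k \<omega>))"
      by (rule Bochner_Integration.integrable_bound[OF IH(1)]) (auto simp: f_def)
    have intg: "integrable M (\<lambda>\<omega>. g (N k \<omega>))"
      by (rule Bochner_Integration.integrable_bound[OF IH(1)]) (auto simp: g_def)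
    have Y: "integrable M (Y (Suc k))" "expectation (Y (Suc k)) \<le> 1"
      using int mean Suc.prems by auto
    \<comment> \<open>Disjoint index blocks are independent, and the stopped product at time
      \<open>k\<close> is a function of the block \<open>{1..k}\<close> only.\<close>
    have "indep_var (PiM {1..k} (\<lambda>_. borel)) (\<lambda>\<omega>. restrict (\<lambda>i. Y i \<omega>) {1..k})
        (PiM {Suc k} (\<lambda>_. borel)) (\<lambda>\<omega>. restrict (\<lambda>i. Y i \<omega>) {Suc k})"
      using Suc.prems by (intro indep_var_restrict[OF indep]) auto
    hence "indep_var borel ((\<lambda>y. g (stopped_prod c y k)) \<circ> (\<lambda>\<omega>. restrict (\<lambda>i. Y i \<omega>) {1..k}))
        borel ((\<lambda>y. y (Suc k)) \<circ> (\<lambda>\<omega>. restrict (\<lambda>i. Y i \<omega>) {Suc k}))"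
      using measurable_stopped_prod[of k "{1..k}" c]
      by (intro indep_var_compose measurable_compose[OF _ fg(2)]) auto
    moreover have "(\<lambda>y. g (stopped_prod c y k)) \<circ> (\<lambda>\<omega>. restrict (\<lambda>i. Y i \<omega>) {1..k})
        = (\<lambda>\<omega>. g (N k \<omega>))"
      by (auto simp: N_def fun_eq_iff intro!: arg_cong[of _ _ g] stopped_prod_cong)
    moreover have "(\<lambda>y. y (Suc k)) \<circ> (\<lambda>\<omega>. restrict (\<lambda>i. Y i \<omega>) {Suc k}) = Y (Suc k)"
      by (auto simp: fun_eq_iff)
    ultimately have ind: "indep_var borel (\<lambda>\<omega>. g (N k \<omega>)) borel (Y (Suc k))" by simp
    note prod = indep_var_integrable[OF ind intg Y(1)]
      indep_var_lebesgue_integral[OF ind intg Y(1)]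
    have step: "N (Suc k) = (\<lambda>\<omega>. f (N k \<omega>) + g (N k \<omega>) * Y (Suc k) \<omega>)"
      by (auto simp: N_def f_def g_def fun_eq_iff)
    have "0 \<le> expectation (\<lambda>\<omega>. g (N k \<omega>))"
      using nn[of k] Suc.prems by (intro integral_nonneg_AE AE_I2) (auto simp: g_def)
    hence "expectation (\<lambda>\<omega>. g (N k \<omega>)) * expectation (Y (Suc k)) \<le> expectation (\<lambda>\<omega>. g (N k \<omega>))"
      using Y(2) mult_left_mono by fastforce
    hence "expectation (N (Suc k)) \<le> expectation (\<lambda>\<omega>. f (N k \<omega>)) + expectation (\<lambda>\<omega>. g (N k \<omega>))"
      unfolding step using intf prod by simp
    also have "\<dots> = expectation (N k)"
      using intf intg by (simp add: split flip: Bochner_Integration.integral_add)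
    finally show ?case using IH(2) intf prod(1) by (simp add: step)
  qed
  have "prob {\<omega> \<in> space M. \<exists>k\<in>{1..m}. c \<le> (\<Prod>i=1..k. Y i \<omega>)} \<le> prob {\<omega> \<in> space M. c \<le> N m \<omega>}"
  proof (rule finite_measure_mono)
    have [measurable]: "N m \<in> borel_measurable M"
      using N[of m] borel_measurable_integrable by blast
    show "{\<omega> \<in> space M. c \<le> N m \<omega>} \<in> events" by measurable
  qed (use prod_ge_imp_stopped_prod_ge in \<open>force simp: N_def\<close>)
  also have "\<dots> \<le> expectation (N m) / c"
    using N[of m] nn[of m] c by (intro integral_Markov_inequality_measure[where A = "space M"]) auto
  also have "\<dots> \<le> 1 / c" using N[of m] c by (simp add: divide_right_mono)
  finally show ?thesis .
qed

section \<open>Exponential moments of the null counts\<close>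

lemma (in prob_space) prob_uniform_le:
  assumes "X \<in> borel_measurable M" "distr M borel X = uniform_measure lborel {0..1}"
    and "0 \<le> t" "t \<le> (1::real)"
  shows "prob {\<omega> \<in> space M. X \<omega> \<le> t} = t"
proof -
  have "prob {\<omega> \<in> space M. X \<omega> \<le> t} = measure (distr M borel X) {..t}"
    using assms(1) by (subst measure_distr) (auto intro!: arg_cong[of _ _ prob])
  also have "\<dots> = measure lborel ({0..1} \<inter> {..t}) / measure lborel {0..1::real}"
    unfolding assms(2) by (rule measure_uniform_measure) auto
  also have "{0..1} \<inter> {..t} = {0..t}" using assms(3,4) by auto
  finally show ?thesis using assms(3) by simp
qed

text \<open>The tilting \<open>ln (1 + (1 - exp (- t)) / B)\<close> is chosen such that the exponential factor of
  each null has mean exactly 1.\<close>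

lemma (in prob_space) expectation_exp_tilted_uniform:
  fixes s lam t :: real
  assumes X: "X \<in> borel_measurable M" "distr M borel X = uniform_measure lborel {0..1}"
    and s: "0 < s" "s \<le> lam" "lam < 1" and t: "0 \<le> t"
  shows "expectation (\<lambda>\<omega>. exp (ln (1 + (1 - exp (- t)) / (s / (1 - lam))) * of_bool (X \<omega> \<le> s)
           - t * of_bool (X \<omega> > lam))) = 1"
proof -
  define u where "u = (1 - exp (- t)) / (s / (1 - lam))"
  have u: "0 \<le> u" unfolding u_def using s t by auto
  define A where "A = {\<omega> \<in> space M. X \<omega> \<le> s}"
  define C where "C = {\<omega> \<in> space M. X \<omega> \<le> lam}"
  have [measurable]: "A \<in> events" "C \<in> events" using X(1) by (auto simp: A_def C_def)
  have pr: "prob A = s" "prob C = lam"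
    unfolding A_def C_def using s by (auto intro!: prob_uniform_le X)
  \<comment> \<open>As \<open>s \<le> lam\<close>, \<open>A\<close> is contained in
    \<open>C\<close>. The three values \<open>1 + u\<close>, \<open>1\<close> and
    \<open>exp (- t)\<close>, taken for \<open>X\<close> up to \<open>s\<close>, between
    \<open>s\<close> and \<open>lam\<close>, and above \<open>lam\<close>, are therefore a linear
    combination of the two indicators and a constant.\<close>
  have "exp (ln (1 + u) * of_bool (X \<omega> \<le> s) - t * of_bool (X \<omega> > lam))
      = exp (- t) + u * indicator A \<omega> + (1 - exp (- t)) * indicator C \<omega>"
    if "\<omega> \<in> space M" for \<omega>
    using that u s by (auto simp: A_def C_def indicator_def)
  hence "expectation (\<lambda>\<omega>. exp (ln (1 + u) * of_bool (X \<omega> \<le> s) - t * of_bool (X \<omega> > lam)))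
      = expectation (\<lambda>\<omega>. exp (- t) + u * indicator A \<omega> + (1 - exp (- t)) * indicator C \<omega>)"
    by (intro Bochner_Integration.integral_cong) auto
  also have "\<dots> = exp (- t) + u * s + (1 - exp (- t)) * lam"
    using pr by (simp add: prob_space emeasure_eq_measure)
  also have "u * s = (1 - exp (- t)) * (1 - lam)" using s by (simp add: u_def)
  finally show ?thesis by (simp add: u_def algebra_simps)
qed

text \<open>Exponentiating turns the event into a product of the factors \<open>h i\<close> reaching
  \<open>exp L\<close>. The factor of a null has mean 1 by the choice of the tilting, and that of a
  non-null is constantly 1, so the maximal inequality applies.\<close>

lemma (in prob_space) null_counts_exponential_bound:
  fixes p :: "nat \<Rightarrow> 'a \<Rightarrow> real" and s lam t L :: real
  assumes indep: "indep_vars (\<lambda>_. borel) p {1..m}"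
    and unif: "\<And>i. i \<in> H0 \<Longrightarrow> distr M borel (p i) = uniform_measure lborel {0..1}"
    and perm: "\<pi> permutes {1..m}"
    and s: "0 < s" "s \<le> lam" "lam < 1" and t: "0 \<le> t"
  shows "prob {\<omega> \<in> space M. \<exists>k\<in>{1..m}.
           L \<le> ln (1 + (1 - exp (- t)) / (s / (1 - lam)))
                 * (\<Sum>i=1..k. of_bool (p (\<pi> i) \<omega> \<le> s \<and> \<pi> i \<in> H0))
               - t * (\<Sum>i=1..k. of_bool (p (\<pi> i) \<omega> > lam \<and> \<pi> i \<in> H0))} \<le> exp (- L)"
proof -
  define l where "l = ln (1 + (1 - exp (- t)) / (s / (1 - lam)))"
  define h where "h i x = exp (l * of_bool (x \<le> s \<and> \<pi> i \<in> H0) - t * of_bool (x > lam \<and> \<pi> i \<in> H0))"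
    for i x
  have h [measurable]: "h i \<in> borel_measurable borel" for i
    unfolding h_def by measurable
  have \<pi>: "\<pi> i \<in> {1..m}" if "i \<in> {1..m}" for i
    using permutes_in_image[OF perm] that by blast
  have p: "p (\<pi> i) \<in> borel_measurable M" if "i \<in> {1..m}" for i
    using indep \<pi>[OF that] unfolding indep_vars_def by auto
  \<comment> \<open>Injectivity makes the singleton blocks \<open>{\<pi> i}\<close> disjoint, so
    independence survives the reordering.\<close>
  have "disjoint_family_on (\<lambda>i. {\<pi> i}) {1..m}"
    using permutes_inj[OF perm] by (auto simp: disjoint_family_on_def inj_def)
  hence "indep_vars (\<lambda>i. PiM {\<pi> i} (\<lambda>_. borel)) (\<lambda>i \<omega>. restrict (\<lambda>j. p j \<omega>) {\<pi> i}) {1..m}"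
    using \<pi> by (intro indep_vars_restrict[OF indep]) auto
  hence "indep_vars (\<lambda>_. borel) (\<lambda>i \<omega>. h i (restrict (\<lambda>j. p j \<omega>) {\<pi> i} (\<pi> i))) {1..m}"
    by (rule indep_vars_compose2) (auto intro!: measurable_compose[OF _ h])
  hence ind: "indep_vars (\<lambda>_. borel) (\<lambda>i \<omega>. h i (p (\<pi> i) \<omega>)) {1..m}" by simp
  have bd: "norm (h i x) \<le> exp (\<bar>l\<bar> + \<bar>t\<bar>)" for i x by (auto simp: h_def)
  have int: "integrable M (\<lambda>\<omega>. h i (p (\<pi> i) \<omega>))" if "i \<in> {1..m}" for i
    using p[OF that] bd by (intro integrable_const_bound) auto
  have mean: "expectation (\<lambda>\<omega>. h i (p (\<pi> i) \<omega>)) \<le> 1" if "i \<in> {1..m}" for i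
    using expectation_exp_tilted_uniform[OF p[OF that] unif s t]
    by (cases "\<pi> i \<in> H0") (auto simp: h_def l_def prob_space)
  have "prob {\<omega> \<in> space M. \<exists>k\<in>{1..m}. exp L \<le> (\<Prod>i=1..k. h i (p (\<pi> i) \<omega>))} \<le> 1 / exp L"
    by (rule indep_prod_maximal_inequality[OF ind _ int mean]) (auto simp: h_def)
  moreover have "(\<Prod>i=1..k. h i (p (\<pi> i) \<omega>))
      = exp (l * (\<Sum>i=1..k. of_bool (p (\<pi> i) \<omega> \<le> s \<and> \<pi> i \<in> H0))
             - t * (\<Sum>i=1..k. of_bool (p (\<pi> i) \<omega> > lam \<and> \<pi> i \<in> H0)))" for k \<omega>
    by (simp only: h_def exp_sum[symmetric] finite_atLeastAtMost sum_subtractf sum_distrib_left)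
  ultimately show ?thesis by (simp add: l_def exp_minus divide_inverse)
qed

section \<open>Counts, infimum and levels\<close>

lemma FDP_preordered_rejections:
  assumes "inj \<pi>"
  shows "FDP H0 (preordered_rejections x \<pi> s k)
    = (\<Sum>i=1..k. of_bool (x (\<pi> i) \<le> s \<and> \<pi> i \<in> H0)) / max 1 (\<Sum>i=1..k. of_bool (x (\<pi> i) \<le> s))"
proof -
  have "preordered_rejections x \<pi> s k = \<pi> ` ({1..k} \<inter> {i. x (\<pi> i) \<le> s})"
    "preordered_rejections x \<pi> s k \<inter> H0 = \<pi> ` ({1..k} \<inter> {i. x (\<pi> i) \<le> s \<and> \<pi> i \<in> H0})"
    by (auto simp: preordered_rejections_def)
  moreover have "card (\<pi> ` C) = card C" for C
    using assms by (intro card_image) (auto simp: inj_def inj_on_def)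
  ultimately show ?thesis
    by (simp add: FDP_def max.commute of_nat_max)
qed

lemma FDP_preordered_rejections_le_1: "FDP H0 (preordered_rejections x \<pi> s k) \<le> 1"
proof -
  have "finite (preordered_rejections x \<pi> s k)"
    by (rule finite_subset[of _ "\<pi> ` {1..k}"]) (auto simp: preordered_rejections_def)
  hence "card (preordered_rejections x \<pi> s k \<inter> H0) \<le> card (preordered_rejections x \<pi> s k)"
    by (intro card_mono) auto
  thus ?thesis by (simp add: FDP_def)
qed

text \<open>Nonnegativity of the terms bounds the real infimum from below, so it behaves as a
  greatest lower bound. Writing \<open>a\<close> as \<open>Suc n\<close> lets the later events be
  indexed by all naturals.\<close>

lemma le_FDP_bar_KR_U_iff:
  assumes "0 < s" "lam < 1" "0 < \<delta>" "\<delta> < 1"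
  shows "r \<le> FDP_bar_KR_U x \<pi> s lam \<delta> k
     \<longleftrightarrow> r \<le> 1 \<and> (\<forall>n. r \<le> KR_term x \<pi> s lam \<delta> k (Suc n))"
proof -
  have "bdd_below (KR_term x \<pi> s lam \<delta> k ` {1..})"
  proof (rule bdd_belowI2)
    fix a :: nat assume "a \<in> {1..}"
    hence "real a / max 1 (\<Sum>i=1..k. of_bool (x (\<pi> i) \<le> s)) \<le> KR_term x \<pi> s lam \<delta> k a"
      using assms by (intro KR_term_ge) auto
    thus "0 \<le> KR_term x \<pi> s lam \<delta> k a"
      by (rule order.trans[rotated]) (auto intro!: divide_nonneg_nonneg)
  qed
  hence "r \<le> (INF a\<in>{1..}. KR_term x \<pi> s lam \<delta> k a) \<longleftrightarrow> (\<forall>a\<ge>1. r \<le> KR_term x \<pi> s lam \<delta> k a)"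
    by (subst le_cINF_iff) auto
  moreover have "(\<forall>a\<ge>1. P a) \<longleftrightarrow> (\<forall>n. P (Suc n))" for P
    by (metis One_nat_def Suc_le_D Suc_le_mono le0)
  ultimately show ?thesis by (simp add: FDP_bar_KR_U_def)
qed

text \<open>The Basel series: the factor \<open>pi\<^sup>2 / 6\<close> in the levels is exactly the
  sum of the reciprocal squares.\<close>

lemma delta_seq_Suc_sums: "(\<lambda>n. delta_seq \<delta> (Suc n)) sums \<delta>"
proof -
  have "(\<lambda>n. \<delta> / (pi\<^sup>2 / 6) * (1 / (real n + 1)\<^sup>2)) sums (\<delta> / (pi\<^sup>2 / 6) * (pi\<^sup>2 / 6))"
    using inverse_squares_sums by (intro sums_mult) (simp add: add.commute)
  thus ?thesis by (simp add: delta_seq_def add.commute)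
qed

text \<open>Each level is a single term of a positive series whose sum \<open>\<delta>\<close> is
  below 1.\<close>

lemma delta_seq_bounds:
  assumes "0 < \<delta>" "\<delta> < 1"
  shows "0 < delta_seq \<delta> (Suc n)" "delta_seq \<delta> (Suc n) < 1"
proof -
  show pos: "0 < delta_seq \<delta> (Suc k)" for k using assms by (simp add: delta_seq_def)
  have "(\<Sum>k\<in>{n}. delta_seq \<delta> (Suc k)) \<le> (\<Sum>k. delta_seq \<delta> (Suc k))"
    using delta_seq_Suc_sums[of \<delta>] pos by (intro sum_le_suminf) (auto simp: sums_iff less_imp_le)
  thus "delta_seq \<delta> (Suc n) < 1"
    using assms delta_seq_Suc_sums[of \<delta>] by (simp add: sums_iff)
qed

text \<open>Discarding the non-nulls from the count of \<open>p\<close>-values above \<open>lam\<close> only enlarges the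
  exponent.\<close>

lemma KR_term_less_FDP_imp_exponent_ge:
  fixes x :: "nat \<Rightarrow> real"
  assumes "inj \<pi>" and s: "0 < s" "lam < 1" and a: "0 < a"
    and d: "0 < delta_seq \<delta> a" "delta_seq \<delta> a < 1"
    and less: "KR_term x \<pi> s lam \<delta> k a < FDP H0 (preordered_rejections x \<pi> s k)"
  defines "L \<equiv> ln (1 / delta_seq \<delta> a)" and "B \<equiv> s / (1 - lam)"
  shows "L \<le> ln (1 + (1 - exp (- (L * B / real a))) / B)
                 * (\<Sum>i=1..k. of_bool (x (\<pi> i) \<le> s \<and> \<pi> i \<in> H0))
               - L * B / real a * (\<Sum>i=1..k. of_bool (x (\<pi> i) > lam \<and> \<pi> i \<in> H0))"
proof -
  define V :: real where "V = (\<Sum>i=1..k. of_bool (x (\<pi> i) \<le> s \<and> \<pi> i \<in> H0))"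
  define W :: real where "W = (\<Sum>i=1..k. of_bool (x (\<pi> i) > lam \<and> \<pi> i \<in> H0))"
  define S :: real where "S = (\<Sum>i=1..k. of_bool (x (\<pi> i) > lam))"
  define N :: real where "N = max 1 (\<Sum>i=1..k. of_bool (x (\<pi> i) \<le> s))"
  define l where "l = ln (1 + (1 - exp (- (L * B / real a))) / B)"
  have B: "0 < B" using s by (simp add: B_def)
  have L: "0 < L" unfolding L_def using d by (intro ln_gt_zero) simp
  have N: "0 < N" by (simp add: N_def)
  have WS: "W \<le> S" unfolding W_def S_def by (intro sum_mono) auto
  \<comment> \<open>This identifies the logarithm in the denominator of \<open>KR_term\<close> with
    the tilting \<open>l\<close> that belongs to \<open>t = L * B / real a\<close>.\<close>
  have pw: "delta_seq \<delta> a powr (B / real a) = exp (- (L * B / real a))"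
    using d by (simp add: powr_def L_def ln_div)
  have l: "0 < l" unfolding l_def using B L a by (intro ln_gt_zero) simp
  have "KR_term x \<pi> s lam \<delta> k a = L / (real a * l) * ((real a + B * S) / N)"
    unfolding KR_term_def Let_def l_def S_def N_def L_def B_def
    by (fold B_def L_def) (simp only: pw)
  moreover have "FDP H0 (preordered_rejections x \<pi> s k) = V / N"
    by (simp add: FDP_preordered_rejections assms(1) V_def N_def)
  ultimately have "L / (real a * l) * (real a + B * S) / N < V / N"
    using less by simp
  hence "L / (real a * l) * (real a + B * S) < V"
    using N by (simp only: divide_less_cancel)
  hence "L * (real a + B * S) < real a * l * V"
    using a l by (simp add: field_simps)
  moreover have "L * (real a + B * W) \<le> L * (real a + B * S)"
    using WS L B by simp
  ultimately have "L * real a + L * B * W < real a * l * V" by (simp add: algebra_simps)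
  \<comment> \<open>Dividing by \<open>a\<close> leaves \<open>L * B / real a\<close> in front of
    \<open>W\<close>, which is where the choice of \<open>t\<close> comes from.\<close>
  hence "L \<le> l * V - L * B / real a * W" using a by (simp add: field_simps)
  thus ?thesis by (simp add: l_def V_def W_def)
qed

section \<open>Union bound over the parameter \<open>a\<close>\<close>

theorem theorem19:
  fixes M :: "'a measure"
    and m :: nat
    and p :: "nat \<Rightarrow> 'a \<Rightarrow> real"
    and H0 :: "nat set"
    and \<pi> :: "nat \<Rightarrow> nat"
    and s \<delta> lam :: real
  assumes "prob_space M"
    and "prob_space.indep_vars M (\<lambda>_. borel) p {1..m}"
    and "\<And>i \<omega>. i \<in> {1..m} \<Longrightarrow> \<omega> \<in> space M \<Longrightarrow> p i \<omega> \<in> {0..1}"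
    and "H0 \<subseteq> {1..m}"
    and "\<And>i. i \<in> H0 \<Longrightarrow> distr M borel (p i) = uniform_measure lborel {0..1}"
    and "\<pi> permutes {1..m}"
    and "s \<in> {0<..1}"
    and "\<delta> \<in> {0<..<1}"
    and "lam \<in> {s..<1}"
  shows "measure M {\<omega> \<in> space M. \<forall>k\<in>{1..m}.
             FDP H0 (preordered_rejections (\<lambda>i. p i \<omega>) \<pi> s k)
               \<le> FDP_bar_KR_U (\<lambda>i. p i \<omega>) \<pi> s lam \<delta> k}
         \<ge> 1 - \<delta>"
proof -
  interpret prob_space M by fact
  have inj: "inj \<pi>" using permutes_inj assms(6) by blast
  have s: "0 < s" "s \<le> lam" "lam < 1" and \<delta>: "0 < \<delta>" "\<delta> < 1" using assms(7-9) by auto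
  define B where "B = s / (1 - lam)"
  define L where "L n = ln (1 / delta_seq \<delta> (Suc n))" for n
  define t where "t n = L n * B / real (Suc n)" for n
  define V where "V k \<omega> = (\<Sum>i=1..k. of_bool (p (\<pi> i) \<omega> \<le> s \<and> \<pi> i \<in> H0) :: real)" for k \<omega>
  define W where "W k \<omega> = (\<Sum>i=1..k. of_bool (p (\<pi> i) \<omega> > lam \<and> \<pi> i \<in> H0) :: real)" for k \<omega>
  define Bad where "Bad n = {\<omega> \<in> space M. \<exists>k\<in>{1..m}.
     L n \<le> ln (1 + (1 - exp (- t n)) / B) * V k \<omega> - t n * W k \<omega>}" for n
  define Good where "Good = {\<omega> \<in> space M. \<forall>k\<in>{1..m}.
             FDP H0 (preordered_rejections (\<lambda>i. p i \<omega>) \<pi> s k)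
               \<le> FDP_bar_KR_U (\<lambda>i. p i \<omega>) \<pi> s lam \<delta> k}"
  have p: "p (\<pi> i) \<in> borel_measurable M" if "i \<in> {1..k}" "k \<in> {1..m}" for i k
    using assms(2) permutes_in_image[OF assms(6), of i] that unfolding indep_vars_def by auto
  \<comment> \<open>The infimum becomes a countable conjunction, which serves both the measurability
    of \<open>Good\<close> and the union bound. The truncation at 1 disappears because the false
    discovery proportion never exceeds 1.\<close>
  have Good_eq: "Good = {\<omega> \<in> space M. \<forall>k\<in>{1..m}. \<forall>n.
      FDP H0 (preordered_rejections (\<lambda>i. p i \<omega>) \<pi> s k) \<le> KR_term (\<lambda>i. p i \<omega>) \<pi> s lam \<delta> k (Suc n)}"
    unfolding Good_def using s \<delta> by (simp add: le_FDP_bar_KR_U_iff FDP_preordered_rejections_le_1)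
  have sum_meas: "(\<lambda>\<omega>. \<Sum>i=1..k. of_bool (P i (p (\<pi> i) \<omega>)) :: real) \<in> borel_measurable M"
    if "k \<in> {1..m}" "\<And>i. Measurable.pred borel (P i)" for k P
  proof (rule borel_measurable_sum)
    fix i assume "i \<in> {1..k}"
    note [measurable] = p[OF this that(1)] that(2)[of i]
    show "(\<lambda>\<omega>. of_bool (P i (p (\<pi> i) \<omega>)) :: real) \<in> borel_measurable M" by measurable
  qed
  have mV: "V k \<in> borel_measurable M" "W k \<in> borel_measurable M" if "k \<in> {1..m}" for k
    unfolding V_def W_def
    using sum_meas[OF that, of "\<lambda>i x. x \<le> s \<and> \<pi> i \<in> H0"]
      sum_meas[OF that, of "\<lambda>i x. x > lam \<and> \<pi> i \<in> H0"] by simp_all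
  define S where "S k \<omega> = (\<Sum>i=1..k. of_bool (p (\<pi> i) \<omega> > lam) :: real)" for k \<omega>
  define R where "R k \<omega> = (\<Sum>i=1..k. of_bool (p (\<pi> i) \<omega> \<le> s) :: real)" for k \<omega>
  have mS: "S k \<in> borel_measurable M" "R k \<in> borel_measurable M" if "k \<in> {1..m}" for k
    unfolding S_def R_def
    using sum_meas[OF that, of "\<lambda>_ x. x > lam"] sum_meas[OF that, of "\<lambda>_ x. x \<le> s"] by simp_all
  have mG: "Good \<in> events"
    unfolding Good_eq
  proof (intro sets.sets_Collect_finite_All sets.sets_Collect_countable_All)
    fix k n assume k: "k \<in> {1..m}"
    note [measurable] = mV(1)[OF k] mS[OF k]
    have FDP: "FDP H0 (preordered_rejections (\<lambda>i. p i \<omega>) \<pi> s k) = V k \<omega> / max 1 (R k \<omega>)" for \<omega>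
      by (simp only: FDP_preordered_rejections[OF inj] V_def R_def)
    \<comment> \<open>For fixed \<open>n\<close> the leading factor does not depend on
      \<open>\<omega>\<close>, so for measurability it can stay an anonymous constant.\<close>
    obtain C where KR: "KR_term (\<lambda>i. p i \<omega>) \<pi> s lam \<delta> k (Suc n)
        = C * ((real (Suc n) + B * S k \<omega>) / max 1 (R k \<omega>))" for \<omega>
      unfolding KR_term_def Let_def S_def R_def B_def by metis
    show "{\<omega> \<in> space M. FDP H0 (preordered_rejections (\<lambda>i. p i \<omega>) \<pi> s k)
        \<le> KR_term (\<lambda>i. p i \<omega>) \<pi> s lam \<delta> k (Suc n)} \<in> events"
      unfolding FDP KR by measurable
  qed auto
  have mB: "Bad n \<in> events" for n
    unfolding Bad_def
  proof (intro sets.sets_Collect_finite_Ex)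
    fix k assume k: "k \<in> {1..m}"
    note [measurable] = mV[OF k]
    show "{\<omega> \<in> space M. L n \<le> ln (1 + (1 - exp (- t n)) / B) * V k \<omega> - t n * W k \<omega>} \<in> events"
      by measurable
  qed auto
  have PB: "prob (Bad n) \<le> delta_seq \<delta> (Suc n)" for n
  proof -
    note d = delta_seq_bounds[OF \<delta>, of n]
    have "0 \<le> L n" unfolding L_def using d by (intro ln_ge_zero) simp
    hence "0 \<le> t n" using s by (simp add: t_def B_def)
    hence "prob (Bad n) \<le> exp (- L n)"
      unfolding Bad_def V_def W_def B_def
      by (intro null_counts_exponential_bound[OF assms(2) assms(5) assms(6) s])
    thus ?thesis using d by (simp add: L_def ln_div)
  qed
  have sub: "space M - Good \<subseteq> (\<Union>n. Bad n)"
  proof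
    fix \<omega> assume "\<omega> \<in> space M - Good"
    then obtain k n where \<omega>: "\<omega> \<in> space M" "k \<in> {1..m}"
      and less: "KR_term (\<lambda>i. p i \<omega>) \<pi> s lam \<delta> k (Suc n)
        < FDP H0 (preordered_rejections (\<lambda>i. p i \<omega>) \<pi> s k)"
      unfolding Good_eq by (auto simp: not_le)
    have "L n \<le> ln (1 + (1 - exp (- t n)) / B) * V k \<omega> - t n * W k \<omega>"
      using KR_term_less_FDP_imp_exponent_ge[OF inj s(1,3) _ delta_seq_bounds[OF \<delta>] less]
      by (simp only: L_def t_def B_def V_def W_def)
    hence "\<omega> \<in> Bad n" using \<omega> unfolding Bad_def by blast
    thus "\<omega> \<in> (\<Union>n. Bad n)" by blast
  qed
  \<comment> \<open>Summability is what gives the real-valued infinite sum of the probabilities its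
    meaning in the union bound.\<close>
  have summ: "summable (\<lambda>n. prob (Bad n))"
    by (rule summable_comparison_test'[where N = 0 and g = "\<lambda>n. delta_seq \<delta> (Suc n)"])
      (use PB delta_seq_Suc_sums[of \<delta>] in \<open>auto simp: sums_iff\<close>)
  have "1 - prob Good = prob (space M - Good)" using mG by (simp add: prob_compl)
  also have "\<dots> \<le> prob (\<Union>n. Bad n)" using sub mB by (intro finite_measure_mono) auto
  also have "\<dots> \<le> (\<Sum>n. prob (Bad n))"
    using mB summ by (intro finite_measure_subadditive_countably) auto
  also have "\<dots> \<le> (\<Sum>n. delta_seq \<delta> (Suc n))"
    using PB summ delta_seq_Suc_sums[of \<delta>] by (intro suminf_le) (auto simp: sums_iff)
  also have "\<dots> = \<delta>" using delta_seq_Suc_sums[of \<delta>] by (simp add: sums_iff)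
  finally show ?thesis unfolding Good_def by simp
qed

end
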